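(* Let $\kappa\in\mathbb C$ with $\operatorname{Re}\kappa>0$ and $\operatorname{Im}\kappa<0$. Let $\eta_+\in[n_1,n_2]$. Then the control system is globally controllable to $\eta_+$: for every $\eta_-\in\hat{\mathbb C}$ there exist a finite time $t\ge0$ and a feasible control steering $x(s_-)=\eta_-$ to $x(s_-+t)=\eta_+$.
   Context: Fix constants $0<n_1<n_2$ and $s_-\in\mathbb R$; $\hat{\mathbb C}=\mathbb C\cup\{\infty\}$. Feasible controls are $\varepsilon\in L^\infty((s_-,\infty);\mathbb R)$ with $n_1^2\le\varepsilon(s)\le n_2^2$ for a.a. $s>s_-$. The state $x(s)\in\hat{\mathbb C}$ of the control system evolves by $x'=\mathrm i\kappa(-x^2+\varepsilon)$ in the chart $\mathbb C$ and, near $\infty$, by $\tilde x'=\mathrm i\kappa(-1+\varepsilon\tilde x^2)$ for $\tilde x=-1/x$. *)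

theory Defs
  imports "HOL-Analysis.Analysis"
begin

text \<open>
  The state space is the Riemann sphere, represented by the carrier of
  \<open>Alexandroff_compactification euclidean\<close>: \<open>None\<close> is the point at infinity.
\<close>

type_synonym riemann_sphere = "complex option"

text \<open>The chart \<open>-1/x\<close> around infinity; it is meaningful only away from \<open>Some 0\<close>.\<close>

definition chart_infinity :: "riemann_sphere \<Rightarrow> complex" where
  "chart_infinity x = (case x of None \<Rightarrow> 0 | Some z \<Rightarrow> - 1 / z)"

text \<open>
  Absolute continuity on an interval \<open>S\<close>: \<open>D\<close> ranges over the finite families of
  non-overlapping compact subintervals \<open>K = {Inf K..Sup K}\<close> of \<open>S\<close>.
\<close>

definition abs_continuous_on :: "real set \<Rightarrow> (real \<Rightarrow> complex) \<Rightarrow> bool" where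
  "abs_continuous_on S f \<longleftrightarrow>
     (\<forall>e>0. \<exists>d>0. \<forall>D. D division_of (\<Union>D) \<longrightarrow> \<Union>D \<subseteq> S \<longrightarrow>
        (\<Sum>K\<in>D. Sup K - Inf K) < d \<longrightarrow> (\<Sum>K\<in>D. norm (f (Sup K) - f (Inf K))) < e)"

definition caratheodory_solution ::
    "(real \<Rightarrow> complex \<Rightarrow> complex) \<Rightarrow> real set \<Rightarrow> (real \<Rightarrow> complex) \<Rightarrow> bool" where
  "caratheodory_solution F J f \<longleftrightarrow>
     abs_continuous_on J f \<and>
     (AE s in lebesgue. s \<in> J \<longrightarrow> (f has_vector_derivative F s (f s)) (at s within J))"

text \<open>
  Solutions on the sphere: near every time the state stays in the domain of one of the two
  charts and solves the equation there. On the overlap of the chart domains the two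
  equations are equivalent, so it does not matter which chart is used. Continuity as a map
  into the sphere is implied.
\<close>

definition trajectory ::
    "complex \<Rightarrow> (real \<Rightarrow> real) \<Rightarrow> real set \<Rightarrow> (real \<Rightarrow> riemann_sphere) \<Rightarrow> bool" where
  "trajectory \<kappa> \<epsilon> I x \<longleftrightarrow>
     (\<forall>s\<in>I. \<exists>\<delta>>0. let J = I \<inter> {s - \<delta>..s + \<delta>} in
        (\<forall>\<sigma>\<in>J. x \<sigma> \<noteq> None) \<and>
          caratheodory_solution (\<lambda>\<sigma> z. \<i> * \<kappa> * (- z\<^sup>2 + complex_of_real (\<epsilon> \<sigma>))) J
            (\<lambda>\<sigma>. the (x \<sigma>))
      \<or> (\<forall>\<sigma>\<in>J. x \<sigma> \<noteq> Some 0) \<and>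
          caratheodory_solution (\<lambda>\<sigma> w. \<i> * \<kappa> * (- 1 + complex_of_real (\<epsilon> \<sigma>) * w\<^sup>2)) J
            (\<lambda>\<sigma>. chart_infinity (x \<sigma>)))"

text \<open>Elements of $L^\infty$ are given by representatives.\<close>

definition Linfinity_on :: "real set \<Rightarrow> (real \<Rightarrow> real) \<Rightarrow> bool" where
  "Linfinity_on S \<epsilon> \<longleftrightarrow>
     \<epsilon> \<in> borel_measurable (lebesgue_on S) \<and> (\<exists>C. AE s in lebesgue_on S. \<bar>\<epsilon> s\<bar> \<le> C)"

definition feasible_control :: "real \<Rightarrow> real \<Rightarrow> real \<Rightarrow> (real \<Rightarrow> real) \<Rightarrow> bool" where
  "feasible_control n\<^sub>1 n\<^sub>2 s\<^sub>0 \<epsilon> \<longleftrightarrow>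
     Linfinity_on {s\<^sub>0<..} \<epsilon> \<and>
     (AE s in lebesgue_on {s\<^sub>0<..}. n\<^sub>1\<^sup>2 \<le> \<epsilon> s \<and> \<epsilon> s \<le> n\<^sub>2\<^sup>2)"

definition steers ::
    "complex \<Rightarrow> real \<Rightarrow> (real \<Rightarrow> real) \<Rightarrow> real \<Rightarrow> riemann_sphere \<Rightarrow> riemann_sphere \<Rightarrow> bool" where
  "steers \<kappa> s\<^sub>0 \<epsilon> t \<xi> \<eta> \<longleftrightarrow>
     (\<exists>x. trajectory \<kappa> \<epsilon> {s\<^sub>0..s\<^sub>0 + t} x \<and> x s\<^sub>0 = \<xi> \<and> x (s\<^sub>0 + t) = \<eta>)"

definition globally_controllable_to ::
    "real \<Rightarrow> real \<Rightarrow> real \<Rightarrow> complex \<Rightarrow> riemann_sphere \<Rightarrow> bool" where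
  "globally_controllable_to n\<^sub>1 n\<^sub>2 s\<^sub>0 \<kappa> \<eta> \<longleftrightarrow>
     (\<forall>\<xi>. \<exists>t\<ge>0. \<exists>\<epsilon>. feasible_control n\<^sub>1 n\<^sub>2 s\<^sub>0 \<epsilon> \<and> steers \<kappa> s\<^sub>0 \<epsilon> t \<xi> \<eta>)"

end

theory Submission
  imports Defs
begin

text \<open>
  Write \<open>\<eta>\<close> for the target, and let \<open>m\<close> be an endpoint of \<open>[n\<^sub>1, n\<^sub>2]\<close> different from it. Only
  the two constant controls \<open>\<eta>\<^sup>2\<close> and \<open>m\<^sup>2\<close> are used.

  Under the constant control \<open>n\<^sup>2\<close> the points \<open>n\<close> and \<open>- n\<close> are equilibria, and the coordinate
  \<open>y = (x - n) / (x + n)\<close>, which sends them to \<open>0\<close> and \<open>\<infinity>\<close>, satisfies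
  \<open>y' = - 2 \<i> \<kappa> n y\<close>. Since \<open>Re \<kappa> > 0\<close> and \<open>Im \<kappa> < 0\<close>, the real part of the rate
  \<open>2 \<i> \<kappa> n\<close> is positive and its imaginary part is nonzero: all states other than \<open>\<plusminus> n\<close>
  move along logarithmic spirals that wind infinitely often around \<open>n\<close>, but never get there.
  On the other hand, solving backwards in time from \<open>\<eta>\<close> with the control \<open>m\<^sup>2\<close> gives a
  curve of states from which \<open>\<eta>\<close> is reached exactly. It emanates from \<open>\<eta>\<close> with nonzero
  velocity, because \<open>\<eta>\<close> is not an equilibrium for \<open>m\<^sup>2\<close>. A spiral that winds around the starting
  point of such a curve has to cross it (\<open>spiral_meets_curve\<close>). Hence one follows the spiral of
  \<open>\<eta>\<^sup>2\<close> up to a crossing and then switches to \<open>m\<^sup>2\<close> (\<open>reachable_equilibrium_from_basin\<close>).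
  The one state not covered, \<open>- \<eta>\<close>, is first left by means of \<open>m\<^sup>2\<close>.

  The point at infinity is treated by projective coordinates. If \<open>p' = \<i> \<kappa> \<epsilon> q\<close> and
  \<open>q' = \<i> \<kappa> p\<close>, with \<open>p\<close> and \<open>q\<close> never vanishing together, then \<open>p / q\<close> solves the equation of the finite
  chart and \<open>- q / p\<close> that of the chart at infinity (\<open>linear_lift_trajectory\<close>). By linearity a lift
  can be multiplied by a nonzero constant, so that pieces of trajectories with a common end point
  can be joined as lifts (\<open>reachable_trans\<close>), with no reference to the charts.
\<close>

section \<open>Quotients as Caratheodory solutions\<close>

lemma lipschitz_imp_abs_continuous_on:
  assumes "L-lipschitz_on S f"
  shows "abs_continuous_on S f"
  unfolding abs_continuous_on_def
proof (intro allI impI)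
  fix e :: real
  assume "e > 0"
  have L: "L \<ge> 0" using assms by (rule lipschitz_on_nonneg)
  show "\<exists>d>0. \<forall>D. D division_of \<Union>D \<longrightarrow> \<Union>D \<subseteq> S \<longrightarrow> (\<Sum>K\<in>D. Sup K - Inf K) < d \<longrightarrow>
          (\<Sum>K\<in>D. norm (f (Sup K) - f (Inf K))) < e"
  proof (intro exI[of _ "e / (L + 1)"] conjI allI impI)
    show "e / (L + 1) > 0" using \<open>e > 0\<close> L by simp
    fix D assume D: "D division_of \<Union>D" and sub: "\<Union>D \<subseteq> S"
      and small: "(\<Sum>K\<in>D. Sup K - Inf K) < e / (L + 1)"
    have K: "norm (f (Sup K) - f (Inf K)) \<le> L * (Sup K - Inf K) \<and> 0 \<le> Sup K - Inf K"
      if "K \<in> D" for K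
    proof -
      obtain a b where ab: "K = {a..b}" "K \<noteq> {}" "K \<subseteq> S"
        using division_ofD(3,4)[OF D \<open>K \<in> D\<close>] sub \<open>K \<in> D\<close>
        by (metis Union_upper cbox_interval order_trans)
      then have "a \<le> b" "a \<in> S" "b \<in> S" by auto
      then show ?thesis using ab lipschitz_on_normD[OF assms, of b a] by auto
    qed
    have "(\<Sum>K\<in>D. norm (f (Sup K) - f (Inf K))) \<le> L * (\<Sum>K\<in>D. Sup K - Inf K)"
      unfolding sum_distrib_left by (rule sum_mono) (use K in blast)
    also have "\<dots> \<le> (L + 1) * (\<Sum>K\<in>D. Sup K - Inf K)"
      by (intro mult_right_mono sum_nonneg) (use K in auto)
    also have "\<dots> < e"
      using small L by (simp add: field_simps)
    finally show "(\<Sum>K\<in>D. norm (f (Sup K) - f (Inf K))) < e" .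
  qed
qed

text \<open>
  On a compact set \<open>u\<close> and \<open>1 / v\<close> are bounded, so the estimate can be read off from
  \<open>u s / v s - u t / v t = (u s - u t) / v s + u t (v t - v s) / (v s v t)\<close>.
\<close>

lemma lipschitz_on_quotient:
  fixes u v :: "real \<Rightarrow> complex"
  assumes "compact S" and u: "L-lipschitz_on S u" and v: "M-lipschitz_on S v"
    and nz: "\<And>s. s \<in> S \<Longrightarrow> v s \<noteq> 0"
  obtains N where "N-lipschitz_on S (\<lambda>s. u s / v s)"
proof -
  have cont: "continuous_on S u" "continuous_on S (\<lambda>s. inverse (v s))"
    using lipschitz_on_continuous_on[OF u] lipschitz_on_continuous_on[OF v] nz
    by (auto intro!: continuous_intros)
  obtain B where B: "B > 0" "\<And>s. s \<in> S \<Longrightarrow> norm (u s) \<le> B"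
    using compact_imp_bounded[OF compact_continuous_image[OF cont(1) \<open>compact S\<close>]]
    by (auto simp: bounded_pos)
  obtain C where C: "C > 0" "\<And>s. s \<in> S \<Longrightarrow> norm (inverse (v s)) \<le> C"
    using compact_imp_bounded[OF compact_continuous_image[OF cont(2) \<open>compact S\<close>]]
    by (auto simp: bounded_pos)
  have LM: "L \<ge> 0" "M \<ge> 0"
    using u v lipschitz_on_nonneg by blast+
  have "(L * C + B * (M * (C * C)))-lipschitz_on S (\<lambda>s. u s / v s)"
  proof (rule lipschitz_onI)
    show "0 \<le> L * C + B * (M * (C * C))"
      using LM B(1) C(1) by simp
    fix s t assume st: "s \<in> S" "t \<in> S"
    have "u s / v s - u t / v t
        = (u s - u t) * inverse (v s) + u t * ((v t - v s) * (inverse (v s) * inverse (v t)))"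
      using nz[OF st(1)] nz[OF st(2)] by (simp add: field_simps)
    also have "norm \<dots> \<le> norm (u s - u t) * norm (inverse (v s))
        + norm (u t) * (norm (v t - v s) * (norm (inverse (v s)) * norm (inverse (v t))))"
      by (metis norm_mult norm_triangle_ineq)
    also have "\<dots> \<le> (L * dist s t) * C + B * ((M * dist s t) * (C * C))"
      using st B C LM lipschitz_on_normD[OF u st] lipschitz_on_normD[OF v st(2) st(1)]
      by (intro add_mono mult_mono) (auto simp: dist_norm norm_minus_commute abs_minus_commute)
    finally show "dist (u s / v s) (u t / v t) \<le> (L * C + B * (M * (C * C))) * dist s t"
      by (simp add: dist_norm algebra_simps)
  qed
  then show ?thesis by (rule that)
qed

lemma has_vector_derivative_quotient:
  fixes f g :: "real \<Rightarrow> complex"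
  assumes "(f has_vector_derivative f') (at x)" and g: "(g has_vector_derivative g') (at x)"
    and nz: "g x \<noteq> 0"
  shows "((\<lambda>t. f t / g t) has_vector_derivative (f' * g x - f x * g') / (g x)\<^sup>2) (at x)"
proof -
  have "((\<lambda>t. inverse (g t)) has_vector_derivative (g' * - (inverse (g x) ^ Suc (Suc 0)))) (at x)"
    using field_vector_diff_chain_at[OF g DERIV_inverse[OF nz]] by (simp add: o_def)
  then have "((\<lambda>t. f t / g t) has_vector_derivative
      f x * (g' * - (inverse (g x) ^ Suc (Suc 0))) + f' * inverse (g x)) (at x)"
    using has_vector_derivative_mult[OF assms(1)] by (simp only: divide_inverse)
  also have "f x * (g' * - (inverse (g x) ^ Suc (Suc 0))) + f' * inverse (g x)
      = (f' * g x - f x * g') / (g x)\<^sup>2"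
    using nz by (simp add: field_simps power2_eq_square)
  finally show ?thesis .
qed

text \<open>
  The common argument for the two charts, which are applied with \<open>u / v = p / q\<close> and
  \<open>u / v = - q / p\<close>. The finite set \<open>K\<close> contains the times at which the control is switched.
\<close>

lemma quotient_caratheodory_solution:
  assumes "compact J" and u: "L-lipschitz_on J u" and v: "M-lipschitz_on J v"
    and nz: "\<And>s. s \<in> J \<Longrightarrow> v s \<noteq> 0"
    and f: "\<And>s. s \<in> J \<Longrightarrow> f s = u s / v s"
    and "finite K"
    and deriv: "\<And>s. s \<in> J - K \<Longrightarrow>
      ((\<lambda>\<sigma>. u \<sigma> / v \<sigma>) has_vector_derivative F s (u s / v s)) (at s)"
  shows "caratheodory_solution F J f"
  unfolding caratheodory_solution_def
proof
  obtain N where "N-lipschitz_on J (\<lambda>s. u s / v s)"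
    using lipschitz_on_quotient[OF \<open>compact J\<close> u v nz] .
  then have "N-lipschitz_on J f"
    by (rule lipschitz_on_transform) (simp add: f)
  then show "abs_continuous_on J f"
    by (rule lipschitz_imp_abs_continuous_on)
  have "K \<in> null_sets lebesgue"
    using finite_imp_null_set_lborel[OF \<open>finite K\<close>] by (rule null_sets_completionI)
  then have "AE s in lebesgue. s \<notin> K" by (rule AE_not_in)
  then show "AE s in lebesgue. s \<in> J \<longrightarrow> (f has_vector_derivative F s (f s)) (at s within J)"
  proof (rule AE_mp, intro AE_I2 impI)
    fix s assume s: "s \<notin> K" "s \<in> J"
    have "((\<lambda>\<sigma>. u \<sigma> / v \<sigma>) has_vector_derivative F s (f s)) (at s within J)"
      using deriv[of s] s f[of s] by (simp add: has_vector_derivative_at_within)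
    with s(2) f show "(f has_vector_derivative F s (f s)) (at s within J)"
      by (rule has_vector_derivative_transform)
  qed
qed

lemma nonzero_near:
  fixes q :: "real \<Rightarrow> complex"
  assumes "continuous_on I q" and "s \<in> I" and "q s \<noteq> 0"
  obtains \<delta> where "\<delta> > 0" and "\<And>\<sigma>. \<sigma> \<in> I \<inter> {s - \<delta>..s + \<delta>} \<Longrightarrow> q \<sigma> \<noteq> 0"
proof -
  obtain e where e: "e > 0" "\<And>\<sigma>. \<sigma> \<in> I \<Longrightarrow> dist s \<sigma> < e \<Longrightarrow> q \<sigma> \<noteq> 0"
    using continuous_on_avoid[OF assms] by (metis dist_commute)
  show ?thesis
    by (rule that[of "e / 2"]) (use e in \<open>auto simp: dist_real_def abs_if\<close>)
qed

section \<open>Linear lifts of the Riccati equation\<close>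

definition projective_ratio :: "complex \<Rightarrow> complex \<Rightarrow> riemann_sphere" where
  "projective_ratio p q = (if q = 0 then None else Some (p / q))"

text \<open>
  Lipschitz continuity stands in for absolute continuity: it suffices because only bounded
  controls occur, and it is preserved by quotients and under concatenation. The exceptional set
  \<open>K\<close> may also absorb the end points of \<open>S\<close>, so that two-sided derivatives can be used.
\<close>

definition linear_lift ::
    "complex \<Rightarrow> (real \<Rightarrow> real) \<Rightarrow> real set \<Rightarrow> (real \<Rightarrow> complex) \<Rightarrow> (real \<Rightarrow> complex) \<Rightarrow> bool" where
  "linear_lift \<kappa> \<epsilon> S p q \<longleftrightarrow>
     (\<exists>L. L-lipschitz_on S p) \<and> (\<exists>L. L-lipschitz_on S q) \<and>
     (\<forall>s\<in>S. p s \<noteq> 0 \<or> q s \<noteq> 0) \<and>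
     (\<exists>K. finite K \<and> (\<forall>s\<in>S - K.
        (p has_vector_derivative \<i> * \<kappa> * of_real (\<epsilon> s) * q s) (at s) \<and>
        (q has_vector_derivative \<i> * \<kappa> * p s) (at s)))"

text \<open>
  Near a time with \<open>q \<noteq> 0\<close> the quotient rule gives
  \<open>(p / q)' = \<i> \<kappa> (\<epsilon> - (p / q)\<^sup>2)\<close>; where \<open>q = 0\<close> one has \<open>p \<noteq> 0\<close>, and in the same
  way \<open>(- q / p)' = \<i> \<kappa> (- 1 + \<epsilon> (- q / p)\<^sup>2)\<close>.
\<close>

lemma linear_lift_trajectory:
  assumes "linear_lift \<kappa> \<epsilon> {a..b} p q"
  shows "trajectory \<kappa> \<epsilon> {a..b} (\<lambda>s. projective_ratio (p s) (q s))"
  unfolding trajectory_def Let_def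
proof
  obtain L M K where p: "L-lipschitz_on {a..b} p" and q: "M-lipschitz_on {a..b} q"
    and pq: "\<And>s. s \<in> {a..b} \<Longrightarrow> p s \<noteq> 0 \<or> q s \<noteq> 0" and "finite K"
    and dp: "\<And>s. s \<in> {a..b} - K \<Longrightarrow>
      (p has_vector_derivative \<i> * \<kappa> * of_real (\<epsilon> s) * q s) (at s)"
    and dq: "\<And>s. s \<in> {a..b} - K \<Longrightarrow> (q has_vector_derivative \<i> * \<kappa> * p s) (at s)"
    using assms unfolding linear_lift_def by blast
  fix s assume s: "s \<in> {a..b}"
  let ?x = "\<lambda>s. projective_ratio (p s) (q s)"
  let ?J = "\<lambda>\<delta>. {a..b} \<inter> {s - \<delta>..s + \<delta>}"
  have lip: "L-lipschitz_on (?J \<delta>) p" "M-lipschitz_on (?J \<delta>) q"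
    "L-lipschitz_on (?J \<delta>) (\<lambda>s. - p s)" "M-lipschitz_on (?J \<delta>) (\<lambda>s. - q s)" for \<delta>
    using p q by (auto intro: lipschitz_on_subset)
  show "\<exists>\<delta>>0.
      (\<forall>\<sigma>\<in>?J \<delta>. ?x \<sigma> \<noteq> None) \<and>
        caratheodory_solution (\<lambda>\<sigma> z. \<i> * \<kappa> * (- z\<^sup>2 + complex_of_real (\<epsilon> \<sigma>))) (?J \<delta>)
          (\<lambda>\<sigma>. the (?x \<sigma>))
      \<or> (\<forall>\<sigma>\<in>?J \<delta>. ?x \<sigma> \<noteq> Some 0) \<and>
        caratheodory_solution (\<lambda>\<sigma> w. \<i> * \<kappa> * (- 1 + complex_of_real (\<epsilon> \<sigma>) * w\<^sup>2)) (?J \<delta>)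
          (\<lambda>\<sigma>. chart_infinity (?x \<sigma>))"
  proof (cases "q s = 0")
    case False
    obtain \<delta> where \<delta>: "\<delta> > 0" and nz: "\<And>\<sigma>. \<sigma> \<in> ?J \<delta> \<Longrightarrow> q \<sigma> \<noteq> 0"
      using nonzero_near[OF lipschitz_on_continuous_on[OF q] s False] by blast
    have "caratheodory_solution (\<lambda>\<sigma> z. \<i> * \<kappa> * (- z\<^sup>2 + complex_of_real (\<epsilon> \<sigma>))) (?J \<delta>)
        (\<lambda>\<sigma>. the (?x \<sigma>))"
    proof (rule quotient_caratheodory_solution[OF _ lip(1,2) nz _ \<open>finite K\<close>])
      fix \<sigma> assume \<sigma>: "\<sigma> \<in> ?J \<delta> - K"
      then have "q \<sigma> \<noteq> 0" using nz by blast
      then have "(\<i> * \<kappa> * of_real (\<epsilon> \<sigma>) * q \<sigma> * q \<sigma> - p \<sigma> * (\<i> * \<kappa> * p \<sigma>)) / (q \<sigma>)\<^sup>2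
          = \<i> * \<kappa> * (- (p \<sigma> / q \<sigma>)\<^sup>2 + complex_of_real (\<epsilon> \<sigma>))"
        by (simp add: field_simps power2_eq_square)
      with has_vector_derivative_quotient[OF dp dq, of \<sigma>] \<sigma> \<open>q \<sigma> \<noteq> 0\<close>
      show "((\<lambda>\<sigma>. p \<sigma> / q \<sigma>) has_vector_derivative
          \<i> * \<kappa> * (- (p \<sigma> / q \<sigma>)\<^sup>2 + complex_of_real (\<epsilon> \<sigma>))) (at \<sigma>)"
        by auto
    qed (use nz in \<open>auto simp: projective_ratio_def\<close>)
    then show ?thesis
      using \<delta> nz by (auto simp: projective_ratio_def)
  next
    case True
    then have "p s \<noteq> 0" using pq[OF s] by blast
    then obtain \<delta> where \<delta>: "\<delta> > 0" and nz: "\<And>\<sigma>. \<sigma> \<in> ?J \<delta> \<Longrightarrow> p \<sigma> \<noteq> 0"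
      using nonzero_near[OF lipschitz_on_continuous_on[OF p] s] by blast
    have "caratheodory_solution (\<lambda>\<sigma> w. \<i> * \<kappa> * (- 1 + complex_of_real (\<epsilon> \<sigma>) * w\<^sup>2)) (?J \<delta>)
        (\<lambda>\<sigma>. chart_infinity (?x \<sigma>))"
    proof (rule quotient_caratheodory_solution[OF _ lip(4,1) nz _ \<open>finite K\<close>])
      fix \<sigma> assume \<sigma>: "\<sigma> \<in> ?J \<delta> - K"
      then have "p \<sigma> \<noteq> 0" using nz by blast
      then have "(- (\<i> * \<kappa> * p \<sigma>) * p \<sigma> - - q \<sigma> * (\<i> * \<kappa> * of_real (\<epsilon> \<sigma>) * q \<sigma>)) / (p \<sigma>)\<^sup>2
          = \<i> * \<kappa> * (- 1 + complex_of_real (\<epsilon> \<sigma>) * (- q \<sigma> / p \<sigma>)\<^sup>2)"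
        by (simp add: field_simps power2_eq_square)
      with has_vector_derivative_quotient[OF has_vector_derivative_minus[OF dq] dp, of \<sigma>]
        \<sigma> \<open>p \<sigma> \<noteq> 0\<close>
      show "((\<lambda>\<sigma>. - q \<sigma> / p \<sigma>) has_vector_derivative
          \<i> * \<kappa> * (- 1 + complex_of_real (\<epsilon> \<sigma>) * (- q \<sigma> / p \<sigma>)\<^sup>2)) (at \<sigma>)"
        by auto
    qed (use nz in \<open>auto simp: projective_ratio_def chart_infinity_def\<close>)
    then show ?thesis
      using \<delta> nz by (auto simp: projective_ratio_def)
  qed
qed

lemma projective_ratio_scale:
  "k \<noteq> 0 \<Longrightarrow> projective_ratio (k * p) (k * q) = projective_ratio p q"
  by (simp add: projective_ratio_def)

lemma projective_ratio_eq_imp_scale: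
  assumes "projective_ratio p q = projective_ratio p' q'"
    and "p \<noteq> 0 \<or> q \<noteq> 0" and "p' \<noteq> 0 \<or> q' \<noteq> 0"
  obtains k where "k \<noteq> 0" and "p = k * p'" and "q = k * q'"
proof (cases "q = 0")
  case True
  then show ?thesis
    using assms by (intro that[of "p / p'"]) (auto simp: projective_ratio_def split: if_splits)
next
  case False
  then show ?thesis
    using assms by (intro that[of "q / q'"]) (auto simp: projective_ratio_def field_simps split: if_splits)
qed

lemma linear_lift_scale:
  assumes "k \<noteq> 0" and "linear_lift \<kappa> \<epsilon> S p q"
  shows "linear_lift \<kappa> \<epsilon> S (\<lambda>s. k * p s) (\<lambda>s. k * q s)"
proof -
  obtain L M K where lift: "L-lipschitz_on S p" "M-lipschitz_on S q"
    "\<forall>s\<in>S. p s \<noteq> 0 \<or> q s \<noteq> 0" "finite K"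
    "\<forall>s\<in>S - K. (p has_vector_derivative \<i> * \<kappa> * of_real (\<epsilon> s) * q s) (at s) \<and>
        (q has_vector_derivative \<i> * \<kappa> * p s) (at s)"
    using assms(2) unfolding linear_lift_def by blast
  have "(norm k * L)-lipschitz_on S (\<lambda>s. k * p s)" "(norm k * M)-lipschitz_on S (\<lambda>s. k * q s)"
    using lift(1,2) unfolding lipschitz_on_def
    by (auto simp: dist_norm norm_mult mult.assoc mult_left_mono simp flip: right_diff_distrib)
  moreover have "((\<lambda>s. k * p s) has_vector_derivative \<i> * \<kappa> * of_real (\<epsilon> s) * (k * q s)) (at s) \<and>
      ((\<lambda>s. k * q s) has_vector_derivative \<i> * \<kappa> * (k * p s)) (at s)" if "s \<in> S - K" for s
    using lift(5) that has_vector_derivative_mult_right[of p _ "at s" k]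
      has_vector_derivative_mult_right[of q _ "at s" k]
    by (metis mult.left_commute)
  ultimately show ?thesis
    unfolding linear_lift_def using lift(3,4) \<open>k \<noteq> 0\<close>
    by (intro conjI exI[of _ K]) (auto intro: exI)
qed

lemma linear_lift_concat:
  assumes "a \<le> b" "b \<le> c"
    and 1: "linear_lift \<kappa> \<epsilon> {a..b} p q" and 2: "linear_lift \<kappa> \<epsilon>' {b..c} p' q'"
    and eq: "p b = p' b" "q b = q' b"
  shows "linear_lift \<kappa> (\<lambda>s. if s \<le> b then \<epsilon> s else \<epsilon>' s) {a..c}
    (\<lambda>s. if s \<le> b then p s else p' s) (\<lambda>s. if s \<le> b then q s else q' s)"
proof -
  have lip: "\<exists>L. L-lipschitz_on {a..c} (\<lambda>s. if s \<le> b then f s else g s)"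
    if "\<exists>L. L-lipschitz_on {a..b} f" "\<exists>L. L-lipschitz_on {b..c} g" "f b = g b"
    for f g :: "real \<Rightarrow> complex"
    using that lipschitz_on_concat_max by blast
  obtain K where K: "finite K" "\<And>s. s \<in> {a..b} - K \<Longrightarrow>
      (p has_vector_derivative \<i> * \<kappa> * of_real (\<epsilon> s) * q s) (at s) \<and>
      (q has_vector_derivative \<i> * \<kappa> * p s) (at s)"
    using 1 unfolding linear_lift_def by blast
  obtain K' where K': "finite K'" "\<And>s. s \<in> {b..c} - K' \<Longrightarrow>
      (p' has_vector_derivative \<i> * \<kappa> * of_real (\<epsilon>' s) * q' s) (at s) \<and>
      (q' has_vector_derivative \<i> * \<kappa> * p' s) (at s)"
    using 2 unfolding linear_lift_def by blast
  have left: "((\<lambda>s. if s \<le> b then f s else g s) has_vector_derivative D) (at s)"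
    if "(f has_vector_derivative D) (at s)" "s < b" for f g :: "real \<Rightarrow> complex" and D s
    using that(1) by (rule has_vector_derivative_transform_within_open[of _ _ _ "{..<b}"]) (use that in auto)
  have right: "((\<lambda>s. if s \<le> b then f s else g s) has_vector_derivative D) (at s)"
    if "(g has_vector_derivative D) (at s)" "b < s" for f g :: "real \<Rightarrow> complex" and D s
    using that(1) by (rule has_vector_derivative_transform_within_open[of _ _ _ "{b<..}"]) (use that in auto)
  have "\<exists>K. finite K \<and> (\<forall>s\<in>{a..c} - K.
      ((\<lambda>s. if s \<le> b then p s else p' s) has_vector_derivative
        \<i> * \<kappa> * of_real (if s \<le> b then \<epsilon> s else \<epsilon>' s) * (if s \<le> b then q s else q' s)) (at s) \<and>
      ((\<lambda>s. if s \<le> b then q s else q' s) has_vector_derivative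
        \<i> * \<kappa> * (if s \<le> b then p s else p' s)) (at s))"
  proof (intro exI[of _ "insert b (K \<union> K')"] conjI ballI)
    fix s assume s: "s \<in> {a..c} - insert b (K \<union> K')"
    have side: "s < b \<or> b < s" using s by auto
    show "((\<lambda>s. if s \<le> b then p s else p' s) has_vector_derivative
        \<i> * \<kappa> * of_real (if s \<le> b then \<epsilon> s else \<epsilon>' s) * (if s \<le> b then q s else q' s)) (at s)"
      using side
    proof (elim disjE)
      assume 1: "s < b"
      then show ?thesis using left[OF _ 1] K(2)[of s] s by simp
    next
      assume 2: "b < s"
      then show ?thesis using right[OF _ 2] K'(2)[of s] s by simp
    qed
    show "((\<lambda>s. if s \<le> b then q s else q' s) has_vector_derivative
        \<i> * \<kappa> * (if s \<le> b then p s else p' s)) (at s)"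
      using side
    proof (elim disjE)
      assume 1: "s < b"
      then show ?thesis using left[OF _ 1] K(2)[of s] s by simp
    next
      assume 2: "b < s"
      then show ?thesis using right[OF _ 2] K'(2)[of s] s by simp
    qed
  qed (use K K' in simp)
  then show ?thesis
    unfolding linear_lift_def
    by (intro conjI lip) (use 1 2 eq in \<open>auto simp: linear_lift_def\<close>)
qed

section \<open>Reachability by concatenated controls\<close>

text \<open>
  The quantification over the initial time \<open>a\<close> expresses that the system is autonomous up to the
  choice of the control; it is what makes the relation transitive.
\<close>

definition reachable :: "complex \<Rightarrow> real set \<Rightarrow> riemann_sphere \<Rightarrow> riemann_sphere \<Rightarrow> bool" where
  "reachable \<kappa> U \<xi> \<eta> \<longleftrightarrow>
     (\<forall>a. \<exists>b\<ge>a. \<exists>\<epsilon> p q. \<epsilon> \<in> borel_measurable borel \<and> range \<epsilon> \<subseteq> U \<and>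
        linear_lift \<kappa> \<epsilon> {a..b} p q \<and>
        projective_ratio (p a) (q a) = \<xi> \<and> projective_ratio (p b) (q b) = \<eta>)"

text \<open>
  The two lifts represent the common state \<open>\<eta>\<close> by proportional vectors. Multiplying the second
  lift by the factor of proportionality makes them agree at the switching time.
\<close>

lemma reachable_trans:
  assumes "reachable \<kappa> U \<xi> \<eta>" and "reachable \<kappa> U \<eta> \<zeta>"
  shows "reachable \<kappa> U \<xi> \<zeta>"
  unfolding reachable_def
proof
  fix a
  obtain b \<epsilon> p q where 1: "b \<ge> a" "\<epsilon> \<in> borel_measurable borel" "range \<epsilon> \<subseteq> U"
    "linear_lift \<kappa> \<epsilon> {a..b} p q" "projective_ratio (p a) (q a) = \<xi>"
    "projective_ratio (p b) (q b) = \<eta>"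
    using assms(1) unfolding reachable_def by meson
  obtain c \<epsilon>' p' q' where 2: "c \<ge> b" "\<epsilon>' \<in> borel_measurable borel" "range \<epsilon>' \<subseteq> U"
    "linear_lift \<kappa> \<epsilon>' {b..c} p' q'" "projective_ratio (p' b) (q' b) = \<eta>"
    "projective_ratio (p' c) (q' c) = \<zeta>"
    using assms(2) unfolding reachable_def by meson
  have nz: "p b \<noteq> 0 \<or> q b \<noteq> 0" "p' b \<noteq> 0 \<or> q' b \<noteq> 0"
    using 1(1,4) 2(1,4) unfolding linear_lift_def by auto
  obtain k where k: "k \<noteq> 0" "p b = k * p' b" "q b = k * q' b"
    using projective_ratio_eq_imp_scale[of "p b" "q b" "p' b" "q' b"] 1(6) 2(5) nz by metis
  let ?glue = "\<lambda>f g s. if s \<le> b then f s else g s"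
  have lift: "linear_lift \<kappa> (?glue \<epsilon> \<epsilon>') {a..c} (?glue p (\<lambda>s. k * p' s)) (?glue q (\<lambda>s. k * q' s))"
    using 1(1) 2(1) 1(4) linear_lift_scale[OF k(1) 2(4)] k(2,3) by (rule linear_lift_concat)
  show "\<exists>c\<ge>a. \<exists>\<epsilon> p q. \<epsilon> \<in> borel_measurable borel \<and> range \<epsilon> \<subseteq> U \<and>
      linear_lift \<kappa> \<epsilon> {a..c} p q \<and>
      projective_ratio (p a) (q a) = \<xi> \<and> projective_ratio (p c) (q c) = \<zeta>"
  proof (rule exI[of _ c], intro conjI exI)
    show "linear_lift \<kappa> (?glue \<epsilon> \<epsilon>') {a..c} (?glue p (\<lambda>s. k * p' s)) (?glue q (\<lambda>s. k * q' s))"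
      by (rule lift)
    show "projective_ratio (?glue p (\<lambda>s. k * p' s) c) (?glue q (\<lambda>s. k * q' s) c) = \<zeta>"
    proof (cases "c = b")
      case True
      then show ?thesis
        using k 2 by (simp add: projective_ratio_scale)
    next
      case False
      then show ?thesis
        using k 2 by (simp add: projective_ratio_scale)
    qed
    show "?glue \<epsilon> \<epsilon>' \<in> borel_measurable borel"
      using 1(2) 2(2) by measurable
  qed (use 1 2 in auto)
qed

lemma reachable_imp_steers:
  assumes "reachable \<kappa> {n\<^sub>1\<^sup>2..n\<^sub>2\<^sup>2} \<xi> \<eta>"
  obtains t \<epsilon> where "t \<ge> 0" and "feasible_control n\<^sub>1 n\<^sub>2 s\<^sub>0 \<epsilon>" and "steers \<kappa> s\<^sub>0 \<epsilon> t \<xi> \<eta>"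
proof -
  obtain b \<epsilon> p q where b: "b \<ge> s\<^sub>0" and meas: "\<epsilon> \<in> borel_measurable borel"
    and range: "range \<epsilon> \<subseteq> {n\<^sub>1\<^sup>2..n\<^sub>2\<^sup>2}" and lift: "linear_lift \<kappa> \<epsilon> {s\<^sub>0..b} p q"
    and ends: "projective_ratio (p s\<^sub>0) (q s\<^sub>0) = \<xi>" "projective_ratio (p b) (q b) = \<eta>"
    using assms unfolding reachable_def by meson
  have "\<epsilon> \<in> borel_measurable (lebesgue_on {s\<^sub>0<..})"
    using meas by (intro measurable_restrict_space1 measurable_completion) simp
  moreover have eps: "n\<^sub>1\<^sup>2 \<le> \<epsilon> s \<and> \<epsilon> s \<le> n\<^sub>2\<^sup>2" for s
    using subsetD[OF range rangeI[of \<epsilon> s]] by simp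
  moreover have "\<bar>\<epsilon> s\<bar> \<le> n\<^sub>2\<^sup>2" for s
    using eps[of s] zero_le_power2[of n\<^sub>1] by linarith
  ultimately have "feasible_control n\<^sub>1 n\<^sub>2 s\<^sub>0 \<epsilon>"
    unfolding feasible_control_def Linfinity_on_def by auto
  moreover have "steers \<kappa> s\<^sub>0 \<epsilon> (b - s\<^sub>0) \<xi> \<eta>"
    unfolding steers_def using linear_lift_trajectory[OF lift] ends
    by (intro exI[of _ "\<lambda>s. projective_ratio (p s) (q s)"]) simp
  ultimately show ?thesis
    using b by (intro that[of "b - s\<^sub>0"]) auto
qed

section \<open>Constant controls\<close>

lemma lipschitz_on_continuous_derivative:
  fixes f :: "real \<Rightarrow> complex"
  assumes "\<And>s. (f has_vector_derivative f' s) (at s)" and "continuous_on {a..b} f'"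
  obtains L where "L-lipschitz_on {a..b} f"
proof -
  obtain C where C: "C > 0" "\<And>s. s \<in> {a..b} \<Longrightarrow> norm (f' s) \<le> C"
    using compact_imp_bounded[OF compact_continuous_image[OF assms(2) compact_Icc]]
    by (auto simp: bounded_pos)
  have "C-lipschitz_on {a..b} f"
  proof (rule bounded_derivative_imp_lipschitz)
    fix s assume s: "s \<in> {a..b}"
    show "(f has_derivative (\<lambda>h. h *\<^sub>R f' s)) (at s within {a..b})"
      using assms(1)[of s] has_derivative_at_withinI unfolding has_vector_derivative_def by blast
    show "onorm (\<lambda>h. h *\<^sub>R f' s) \<le> C"
      using C(2)[OF s] by (intro onorm_le) (simp add: mult.commute[of C] mult_left_mono)
  qed (use C in auto)
  then show ?thesis by (rule that)
qed

lemma exp_has_vector_derivative: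
  fixes \<omega> :: complex
  shows "((\<lambda>s. exp (\<omega> * of_real (s - a))) has_vector_derivative \<omega> * exp (\<omega> * of_real (s - a))) (at s)"
proof -
  have "((\<lambda>z. exp (\<omega> * (z - of_real a))) has_field_derivative
      \<omega> * exp (\<omega> * (of_real s - of_real a))) (at (of_real s))"
    by (auto intro!: derivative_eq_intros)
  from has_vector_derivative_real_field[OF this] show ?thesis
    by simp
qed

text \<open>
  The inverse of the Moebius transformation \<open>x \<mapsto> (x - n) / (x + n)\<close>, which conjugates the flow
  of the constant control \<open>n\<^sup>2\<close> to a linear one. It misses only the state \<open>- n\<close>, which would be
  \<open>y = \<infinity>\<close>.
\<close>

definition state_at :: "real \<Rightarrow> complex \<Rightarrow> riemann_sphere" where
  "state_at n y = projective_ratio (of_real n * (1 + y)) (1 - y)"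

lemma state_at_0: "state_at n 0 = Some (of_real n)"
  by (simp add: state_at_def projective_ratio_def)

lemma state_at_exists:
  assumes "n > 0" and "\<xi> \<noteq> Some (- of_real n)"
  obtains y where "\<xi> = state_at n y"
proof (cases \<xi>)
  case None
  then show ?thesis
    by (intro that[of 1]) (simp add: state_at_def projective_ratio_def)
next
  case (Some x)
  then have nz: "x + of_real n \<noteq> 0"
    using assms(2) by (auto simp: add_eq_0_iff2)
  let ?k = "2 * of_real n / (x + of_real n)" and ?y = "(x - of_real n) / (x + of_real n)"
  have "?k * x = of_real n * (1 + ?y)" "?k * 1 = 1 - ?y"
    using nz by (auto simp: field_simps)
  moreover have "projective_ratio (?k * x) (?k * 1) = projective_ratio x 1"
    using nz \<open>n > 0\<close> by (intro projective_ratio_scale) auto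
  ultimately have "state_at n ?y = projective_ratio x 1"
    unfolding state_at_def by metis
  with Some show ?thesis
    by (intro that[of ?y]) (simp add: projective_ratio_def)
qed

text \<open>
  For \<open>\<epsilon> = n\<^sup>2\<close> the matrix of the linear system has the eigenvectors \<open>(n, 1)\<close> and \<open>(n, - 1)\<close> with
  eigenvalues \<open>\<plusminus> \<omega>\<close>, where \<open>\<omega> = \<i> \<kappa> n\<close>. The coordinate \<open>y\<close> is the quotient of the coefficients
  of the solution in this basis, hence is multiplied by \<open>exp (- 2 \<omega> t)\<close>.
\<close>

lemma reachable_constant_control:
  assumes "n > 0" and "n\<^sup>2 \<in> U" and "t \<ge> 0"
  shows "reachable \<kappa> U (state_at n y) (state_at n (y * exp (- (2 * \<i> * \<kappa> * of_real n * of_real t))))"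
  unfolding reachable_def
proof
  fix a :: real
  define \<omega> where "\<omega> = \<i> * \<kappa> * of_real n"
  define E where "E = (\<lambda>s. exp (\<omega> * of_real (s - a)))"
  define E' where "E' = (\<lambda>s. exp (- \<omega> * of_real (s - a)))"
  define p where "p = (\<lambda>s. of_real n * (E s + y * E' s))"
  define q where "q = (\<lambda>s. E s - y * E' s)"
  have E_nz: "E s \<noteq> 0" for s by (simp add: E_def)
  have dE: "(E has_vector_derivative \<omega> * E s) (at s)"
    "(E' has_vector_derivative - \<omega> * E' s) (at s)" for s
    unfolding E_def E'_def by (rule exp_has_vector_derivative)+
  have dp: "(p has_vector_derivative \<i> * \<kappa> * of_real (n\<^sup>2) * q s) (at s)" for s
  proof -
    have "(p has_vector_derivative of_real n * (\<omega> * E s + y * (- \<omega> * E' s))) (at s)"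
      unfolding p_def by (intro has_vector_derivative_mult_right has_vector_derivative_add dE)
    also have "of_real n * (\<omega> * E s + y * (- \<omega> * E' s)) = \<i> * \<kappa> * of_real (n\<^sup>2) * q s"
      by (simp add: q_def \<omega>_def algebra_simps power2_eq_square)
    finally show ?thesis .
  qed
  have dq: "(q has_vector_derivative \<i> * \<kappa> * p s) (at s)" for s
  proof -
    have "(q has_vector_derivative \<omega> * E s - y * (- \<omega> * E' s)) (at s)"
      unfolding q_def by (intro has_vector_derivative_mult_right has_vector_derivative_diff dE)
    also have "\<omega> * E s - y * (- \<omega> * E' s) = \<i> * \<kappa> * p s"
      by (simp add: p_def \<omega>_def algebra_simps)
    finally show ?thesis .
  qed
  have "continuous_on {a..a + t} p" "continuous_on {a..a + t} q"
    unfolding p_def q_def E_def E'_def by (intro continuous_intros)+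
  then have "\<exists>L. L-lipschitz_on {a..a + t} p" "\<exists>L. L-lipschitz_on {a..a + t} q"
    using lipschitz_on_continuous_derivative[OF dp, of a "a + t"]
      lipschitz_on_continuous_derivative[OF dq, of a "a + t"]
    by (metis continuous_on_mult_left)+
  moreover have "p s \<noteq> 0 \<or> q s \<noteq> 0" for s
  proof (rule ccontr)
    assume "\<not> ?thesis"
    then have "E s + y * E' s = 0" "E s - y * E' s = 0"
      using \<open>n > 0\<close> by (auto simp: p_def q_def)
    then have "2 * E s = 0" by algebra
    then show False using E_nz by simp
  qed
  ultimately have lift: "linear_lift \<kappa> (\<lambda>_. n\<^sup>2) {a..a + t} p q"
    unfolding linear_lift_def using dp dq by blast
  have start: "projective_ratio (p a) (q a) = state_at n y"
    by (simp add: p_def q_def E_def E'_def state_at_def)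
  let ?Y = "y * exp (- (2 * \<i> * \<kappa> * of_real n * of_real t))"
  have "E (a + t) * exp (- (2 * \<i> * \<kappa> * of_real n * of_real t)) = E' (a + t)"
    unfolding E_def E'_def \<omega>_def by (simp flip: exp_add add: algebra_simps)
  then have "p (a + t) = E (a + t) * (of_real n * (1 + ?Y))" "q (a + t) = E (a + t) * (1 - ?Y)"
    by (simp_all add: p_def q_def algebra_simps)
  then have "projective_ratio (p (a + t)) (q (a + t)) = state_at n ?Y"
    unfolding state_at_def using projective_ratio_scale[OF E_nz] by metis
  then show "\<exists>b\<ge>a. \<exists>\<epsilon> p q. \<epsilon> \<in> borel_measurable borel \<and> range \<epsilon> \<subseteq> U \<and>
      linear_lift \<kappa> \<epsilon> {a..b} p q \<and>
      projective_ratio (p a) (q a) = state_at n y \<and> projective_ratio (p b) (q b) = state_at n ?Y"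
    using lift start \<open>n\<^sup>2 \<in> U\<close> \<open>t \<ge> 0\<close>
    by (intro exI[of _ "a + t"] conjI exI[of _ "\<lambda>_. n\<^sup>2"] exI[of _ p] exI[of _ q]) auto
qed

text \<open>
  The change between the linearising coordinates of the controls \<open>m\<^sup>2\<close> and \<open>n\<^sup>2\<close>. It turns orbits of \<open>m\<^sup>2\<close>
  into curves in the coordinate in which the orbits of \<open>n\<^sup>2\<close> are spirals around \<open>0\<close>.
\<close>

lemma state_at_change:
  fixes m n :: real and z :: complex
  assumes "n > 0" and "of_real (m + n) + of_real (m - n) * z \<noteq> 0"
  shows "state_at n ((of_real (m - n) + of_real (m + n) * z) / (of_real (m + n) + of_real (m - n) * z))
    = state_at m z" (is "state_at n (?N / ?D) = _")
proof -
  have "2 * of_real n / ?D * (of_real m * (1 + z)) = of_real n * (1 + ?N / ?D)"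
    "2 * of_real n / ?D * (1 - z) = 1 - ?N / ?D"
    using assms(2) by (simp_all add: field_simps)
  then show ?thesis
    unfolding state_at_def
    using projective_ratio_scale[of "2 * of_real n / ?D" "of_real m * (1 + z)" "1 - z"] assms by auto
qed

section \<open>A spiral crosses every curve issuing from its centre\<close>

lemma polar_Ln: 
  assumes "z \<noteq> 0"
  shows "z = of_real (norm z) * cis (Im (Ln z))"
  using exp_eq_polar[of "Ln z"] assms by simp

text \<open>
  For small \<open>\<tau> > 0\<close> there is exactly one time \<open>t \<tau>\<close> at which the spiral has the modulus of
  \<open>c \<tau>\<close>. What has to be found is a \<open>\<tau>\<close> for which the arguments also agree modulo \<open>2 \<pi>\<close>. As
  \<open>\<tau> \<rightarrow> 0\<close>, the argument of \<open>c \<tau>\<close> stays bounded, since \<open>c\<close> has a tangent at \<open>0\<close>, whereas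
  \<open>t \<tau> \<rightarrow> \<infinity>\<close> and the argument of the spiral tends to \<open>- \<infinity>\<close>. So the difference \<open>\<theta>\<close> of the arguments
  takes some value in \<open>2 \<pi> \<int>\<close> by the intermediate value theorem.
\<close>

lemma spiral_meets_curve:
  fixes c :: "real \<Rightarrow> complex"
  assumes "r > 0" and cont: "continuous_on {0..r} c" and "c 0 = 0"
    and deriv: "(c has_vector_derivative v) (at 0 within {0..r})" and "v \<noteq> 0"
    and \<nu>: "Re \<nu> > 0" "Im \<nu> > 0" and "y \<noteq> 0"
  obtains t \<tau> where "t \<ge> 0" and "\<tau> \<in> {0..r}" and "y * exp (- (\<nu> * of_real t)) = c \<tau>"
proof -
  obtain d where d: "d > 0"
    "\<And>\<tau>. \<tau> \<in> {0..r} \<Longrightarrow> \<tau> < d \<Longrightarrow> norm (c \<tau> - \<tau> *\<^sub>R v) \<le> norm v / 2 * \<tau>"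
  proof -
    have "\<exists>d>0. \<forall>\<tau>\<in>{0..r}. norm (\<tau> - 0) < d \<longrightarrow>
        norm (c \<tau> - c 0 - (\<tau> - 0) *\<^sub>R v) \<le> norm v / 2 * norm (\<tau> - 0)"
      using deriv \<open>v \<noteq> 0\<close> unfolding has_vector_derivative_def has_derivative_within_alt
      by (metis half_gt_zero zero_less_norm_iff)
    with \<open>c 0 = 0\<close> show ?thesis
      by (auto intro: that)
  qed
  have small: "\<exists>\<rho>. 0 < \<rho> \<and> \<rho> \<le> r \<and> (\<forall>\<tau>\<in>{0..\<rho>}. norm (c \<tau>) < e)" if "e > 0" for e
  proof -
    obtain h where h: "h > 0" "\<And>\<tau>. \<tau> \<in> {0..r} \<Longrightarrow> dist \<tau> 0 < h \<Longrightarrow> dist (c \<tau>) (c 0) < e"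
      using cont[unfolded continuous_on_iff, rule_format, of 0 e] \<open>e > 0\<close> \<open>r > 0\<close> by auto
    show ?thesis
      using h \<open>r > 0\<close> \<open>c 0 = 0\<close> by (intro exI[of _ "min r (h / 2)"]) auto
  qed
  obtain \<rho>1 where \<rho>1: "0 < \<rho>1" "\<rho>1 \<le> r" "\<And>\<tau>. \<tau> \<in> {0..\<rho>1} \<Longrightarrow> norm (c \<tau>) < norm y"
    using small[of "norm y"] \<open>y \<noteq> 0\<close> by auto
  define \<rho> where "\<rho> = min \<rho>1 (d / 2)"
  have \<rho>: "0 < \<rho>" "\<rho> \<le> \<rho>1" "\<rho> \<le> r" "\<rho> < d"
    using \<rho>1 d by (auto simp: \<rho>_def)
  \<comment> \<open>The direction of \<open>c \<tau>\<close> relative to the tangent \<open>v\<close>. It stays in the right half plane, where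
    \<open>Ln\<close> is continuous with imaginary part bounded by \<open>\<pi> / 2\<close>.\<close>
  define w where "w = (\<lambda>\<tau>. c \<tau> / (of_real \<tau> * v))"
  have w: "Re (w \<tau>) > 0" if "0 < \<tau>" "\<tau> \<le> \<rho>" for \<tau>
  proof -
    have "w \<tau> - 1 = (c \<tau> - \<tau> *\<^sub>R v) / (of_real \<tau> * v)"
      using that \<open>v \<noteq> 0\<close> by (simp add: w_def field_simps scaleR_conv_of_real)
    then have "norm (w \<tau> - 1) = norm (c \<tau> - \<tau> *\<^sub>R v) / (\<tau> * norm v)"
      using that by (simp add: norm_divide norm_mult)
    also have "\<dots> \<le> (norm v / 2 * \<tau>) / (\<tau> * norm v)"
      using d(2)[of \<tau>] that \<rho> by (intro divide_right_mono) auto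
    also have "\<dots> = 1 / 2"
      using that \<open>v \<noteq> 0\<close> by simp
    finally show ?thesis
      using abs_Re_le_cmod[of "w \<tau> - 1"] by simp
  qed
  have c_nz: "c \<tau> \<noteq> 0" if "0 < \<tau>" "\<tau> \<le> \<rho>" for \<tau>
    using w[OF that] by (auto simp: w_def)
  define t where "t = (\<lambda>\<tau>. ln (norm y / norm (c \<tau>)) / Re \<nu>)"
  define \<theta> where "\<theta> = (\<lambda>\<tau>. Im (Ln y) - Im \<nu> * t \<tau> - Im (Ln (w \<tau>)) - Im (Ln v))"
  have t_ge: "T \<le> t \<tau>" if "0 < \<tau>" "\<tau> \<le> \<rho>" "norm (c \<tau>) \<le> norm y * exp (- (Re \<nu> * T))" for \<tau> T
  proof -
    have "exp (Re \<nu> * T) \<le> norm y / norm (c \<tau>)"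
      using that c_nz[OF that(1,2)] by (simp add: exp_minus field_simps)
    then have "Re \<nu> * T \<le> ln (norm y / norm (c \<tau>))"
      using c_nz[OF that(1,2)] \<open>y \<noteq> 0\<close> by (simp add: ln_ge_iff)
    then show ?thesis
      using \<nu> by (simp add: t_def field_simps)
  qed
  have hit: "y * exp (- (\<nu> * of_real (t \<tau>))) = c \<tau>"
    if \<tau>: "0 < \<tau>" "\<tau> \<le> \<rho>" and \<theta>: "\<theta> \<tau> = 2 * pi * of_int k" for \<tau> k
  proof -
    have w_nz: "w \<tau> \<noteq> 0" using w[OF \<tau>] by auto
    have "exp (- (Re \<nu> * t \<tau>)) = norm (c \<tau>) / norm y"
      using \<nu> c_nz[OF \<tau>] \<open>y \<noteq> 0\<close> by (simp add: t_def exp_minus)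
    then have "exp (- (\<nu> * of_real (t \<tau>))) = of_real (norm (c \<tau>) / norm y) * cis (- (Im \<nu> * t \<tau>))"
      by (subst exp_eq_polar) simp
    then have "y * exp (- (\<nu> * of_real (t \<tau>)))
        = of_real (norm (c \<tau>)) * (cis (Im (Ln y)) * cis (- (Im \<nu> * t \<tau>)))"
      using \<open>y \<noteq> 0\<close> by (subst polar_Ln[of y]) (auto simp: field_simps)
    also have "cis (Im (Ln y)) * cis (- (Im \<nu> * t \<tau>))
        = cis (Im (Ln (w \<tau>)) + Im (Ln v) + 2 * pi * of_int k)"
      using \<theta> by (simp add: cis_mult \<theta>_def algebra_simps)
    also have "\<dots> = cis (Im (Ln (w \<tau>))) * cis (Im (Ln v))"
      by (simp flip: cis_mult add: cis_multiple_2pi)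
    also have "of_real (norm (c \<tau>)) * \<dots>
        = of_real \<tau> * (of_real (norm (w \<tau>)) * cis (Im (Ln (w \<tau>)))) * (of_real (norm v) * cis (Im (Ln v)))"
      using \<tau> \<open>v \<noteq> 0\<close> by (simp add: w_def norm_divide norm_mult)
    also have "\<dots> = of_real \<tau> * w \<tau> * v"
      using polar_Ln[OF w_nz] polar_Ln[OF \<open>v \<noteq> 0\<close>] by simp
    also have "\<dots> = c \<tau>"
      using \<tau> \<open>v \<noteq> 0\<close> by (simp add: w_def)
    finally show ?thesis .
  qed
  define k where "k = \<lfloor>\<theta> \<rho> / (2 * pi)\<rfloor>"
  have k: "2 * pi * of_int k \<le> \<theta> \<rho>"
    using of_int_floor_le[of "\<theta> \<rho> / (2 * pi)"] unfolding k_def[symmetric] by (simp add: field_simps)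
  \<comment> \<open>From time \<open>T\<close> on, the rotation \<open>Im \<nu> * t\<close> is large enough to push \<open>\<theta>\<close> below \<open>2 \<pi> k\<close>: the
    terms \<open>Im (Ln y)\<close> and \<open>- Im (Ln (w \<tau>))\<close> together contribute at most \<open>3 \<pi> / 2 < 2 \<pi>\<close>.\<close>
  define T where "T = (2 * pi - 2 * pi * of_int k - Im (Ln v)) / Im \<nu>"
  obtain \<rho>2 where \<rho>2: "0 < \<rho>2" "\<forall>\<tau>\<in>{0..\<rho>2}. norm (c \<tau>) < norm y * exp (- (Re \<nu> * T))"
    using small[of "norm y * exp (- (Re \<nu> * T))"] \<open>y \<noteq> 0\<close> by auto
  define \<rho>3 where "\<rho>3 = min \<rho> \<rho>2"
  have \<rho>3: "0 < \<rho>3" "\<rho>3 \<le> \<rho>" "\<rho>3 \<in> {0..\<rho>2}"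
    using \<rho> \<rho>2 by (auto simp: \<rho>3_def)
  have "\<theta> \<rho>3 \<le> 2 * pi * of_int k"
  proof -
    have "T \<le> t \<rho>3"
      using \<rho>2(2) \<rho>3 by (intro t_ge) (auto intro: less_imp_le)
    then have "Im \<nu> * T \<le> Im \<nu> * t \<rho>3"
      using \<nu> by simp
    moreover have "Im \<nu> * T = 2 * pi - 2 * pi * of_int k - Im (Ln v)"
      using \<nu> by (simp add: T_def)
    moreover have "\<bar>Im (Ln (w \<rho>3))\<bar> < pi / 2"
      using w[OF \<rho>3(1,2)] by (rule Re_Ln_pos_lt_imp)
    moreover have "Im (Ln y) \<le> pi"
      using \<open>y \<noteq> 0\<close> by (rule Im_Ln_le_pi)
    ultimately show ?thesis
      unfolding \<theta>_def using pi_gt_zero by argo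
  qed
  moreover have "continuous_on {\<rho>3..\<rho>} \<theta>"
  proof -
    have c_cont: "continuous_on {\<rho>3..\<rho>} c"
      using cont by (rule continuous_on_subset) (use \<rho> \<rho>3 in auto)
    have w_cont: "continuous_on {\<rho>3..\<rho>} w"
      unfolding w_def using \<rho>3 \<open>v \<noteq> 0\<close> by (intro continuous_intros c_cont) auto
    have "w \<tau> \<notin> \<real>\<^sub>\<le>\<^sub>0" if "\<tau> \<in> {\<rho>3..\<rho>}" for \<tau>
      using w[of \<tau>] that \<rho>3 by (auto simp: complex_nonpos_Reals_iff)
    moreover have "c \<tau> \<noteq> 0" if "\<tau> \<in> {\<rho>3..\<rho>}" for \<tau>
      using c_nz[of \<tau>] that \<rho>3 by auto
    ultimately show ?thesis
      unfolding \<theta>_def t_def using \<open>y \<noteq> 0\<close> \<nu> by (intro continuous_intros c_cont w_cont) auto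
  qed
  ultimately obtain \<tau> where \<tau>: "\<rho>3 \<le> \<tau>" "\<tau> \<le> \<rho>" "\<theta> \<tau> = 2 * pi * of_int k"
    using IVT'[of \<theta> \<rho>3 "2 * pi * of_int k" \<rho>] k \<rho>3 by blast
  show ?thesis
  proof (rule that)
    show "t \<tau> \<ge> 0"
      using \<rho>1(3)[of \<tau>] \<tau> \<rho> \<rho>3 by (intro t_ge) auto
    show "\<tau> \<in> {0..r}"
      using \<tau> \<rho> \<rho>3 by auto
    show "y * exp (- (\<nu> * of_real (t \<tau>))) = c \<tau>"
      using \<tau> \<rho>3 by (intro hit) auto
  qed
qed

section \<open>Global controllability\<close>

text \<open>
  In the coordinate of \<open>n\<^sup>2\<close>, the orbit of \<open>m\<^sup>2\<close> that arrives at \<open>n\<close> after time \<open>\<tau>\<close> starts at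
  \<open>N \<tau> / D \<tau>\<close>. This is a curve that issues from \<open>0\<close> with a velocity \<open>v \<noteq> 0\<close>, so the spiral
  through \<open>y\<close> meets it.
\<close>

lemma reachable_equilibrium_from_basin:
  assumes \<kappa>: "Re \<kappa> > 0" "Im \<kappa> < 0" and mn: "m > 0" "n > 0" "m \<noteq> n"
    and U: "m\<^sup>2 \<in> U" "n\<^sup>2 \<in> U" and "y \<noteq> 0"
  shows "reachable \<kappa> U (state_at n y) (Some (of_real n))"
proof -
  define \<mu> where "\<mu> = 2 * \<i> * \<kappa> * of_real m"
  define z0 :: complex where "z0 = of_real ((n - m) / (n + m))"
  \<comment> \<open>\<open>z0\<close> is the equilibrium \<open>n\<close> in the coordinate of \<open>m\<^sup>2\<close>, and \<open>z \<tau>\<close> the state on its backward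
    orbit from which \<open>n\<close> is reached after time \<open>\<tau>\<close>.\<close>
  define z where "z = (\<lambda>\<tau>::real. z0 * exp (\<mu> * of_real \<tau>))"
  define N where "N = (\<lambda>\<tau>. of_real (m - n) + of_real (m + n) * z \<tau>)"
  define D where "D = (\<lambda>\<tau>. of_real (m + n) + of_real (m - n) * z \<tau>)"
  have "\<kappa> \<noteq> 0" using \<kappa> by auto
  have dz: "(z has_vector_derivative z0 * \<mu>) (at 0)"
    using has_vector_derivative_mult_right[OF exp_has_vector_derivative[of \<mu> 0 0], of z0]
    by (simp add: z_def)
  have dN: "(N has_vector_derivative of_real (m + n) * (z0 * \<mu>)) (at 0)"
    and dD: "(D has_vector_derivative of_real (m - n) * (z0 * \<mu>)) (at 0)"
    unfolding N_def D_def using dz by (auto intro!: derivative_eq_intros)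
  have N0: "N 0 = 0"
    using mn by (simp add: N_def z_def z0_def field_simps flip: of_real_add of_real_diff of_real_divide of_real_mult)
  have D0: "D 0 \<noteq> 0"
  proof -
    have "D 0 = of_real (4 * m * n / (n + m))"
      using mn by (simp add: D_def z_def z0_def field_simps flip: of_real_add of_real_diff of_real_divide of_real_mult)
    then show ?thesis using mn by (simp flip: of_real_add)
  qed
  have cont_N: "continuous_on S N" and cont_D: "continuous_on S D" for S
    unfolding N_def D_def z_def by (intro continuous_intros)+
  obtain r where r: "r > 0" "r \<le> 1" "\<And>\<tau>. \<tau> \<in> {0..r} \<Longrightarrow> D \<tau> \<noteq> 0"
  proof -
    obtain \<delta> where "\<delta> > 0" "\<And>\<tau>. \<tau> \<in> {0..1} \<inter> {0 - \<delta>..0 + \<delta>} \<Longrightarrow> D \<tau> \<noteq> 0"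
      using nonzero_near[OF cont_D[of "{0..1}"], of 0] D0 by (metis atLeastAtMost_iff order_refl zero_le_one)
    then show ?thesis
      by (intro that[of "min 1 \<delta>"]) auto
  qed
  define v where "v = (of_real (m + n) * (z0 * \<mu>) * D 0 - N 0 * (of_real (m - n) * (z0 * \<mu>))) / (D 0)\<^sup>2"
  have "v \<noteq> 0"
  proof -
    have "z0 \<noteq> 0" using mn by (simp add: z0_def flip: of_real_add of_real_diff)
    moreover have "\<mu> \<noteq> 0" using mn \<open>\<kappa> \<noteq> 0\<close> by (simp add: \<mu>_def)
    moreover have "of_real (m + n) \<noteq> (0::complex)" using mn by (simp del: of_real_add)
    ultimately show ?thesis
      unfolding v_def N0 using D0 by simp
  qed
  have "((\<lambda>\<tau>. N \<tau> / D \<tau>) has_vector_derivative v) (at 0 within {0..r})"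
    unfolding v_def
    by (rule has_vector_derivative_at_within[OF has_vector_derivative_quotient[OF dN dD D0]])
  moreover have "continuous_on {0..r} (\<lambda>\<tau>. N \<tau> / D \<tau>)"
    using r(3) by (intro continuous_on_divide cont_N cont_D) blast
  moreover have "Re (2 * \<i> * \<kappa> * of_real n) > 0" "Im (2 * \<i> * \<kappa> * of_real n) > 0"
    using \<kappa> mn by (simp_all add: mult_neg_pos)
  ultimately obtain t \<tau> where t: "t \<ge> 0" and \<tau>: "\<tau> \<in> {0..r}"
    and hit: "y * exp (- (2 * \<i> * \<kappa> * of_real n * of_real t)) = N \<tau> / D \<tau>"
    using spiral_meets_curve[of r "\<lambda>\<tau>. N \<tau> / D \<tau>" v "2 * \<i> * \<kappa> * of_real n" y] r(1) N0 \<open>v \<noteq> 0\<close> \<open>y \<noteq> 0\<close>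
    by auto
  have "reachable \<kappa> U (state_at n y) (state_at n (N \<tau> / D \<tau>))"
    using reachable_constant_control[OF mn(2) U(2) t, of \<kappa> y] unfolding hit .
  also have "state_at n (N \<tau> / D \<tau>) = state_at m (z \<tau>)"
    using r(3)[OF \<tau>] state_at_change[OF mn(2)] unfolding N_def D_def by blast
  finally have to_curve: "reachable \<kappa> U (state_at n y) (state_at m (z \<tau>))" .
  have "z \<tau> * exp (- (2 * \<i> * \<kappa> * of_real m * of_real \<tau>)) = z0"
    unfolding z_def \<mu>_def by (simp add: exp_minus)
  then have "reachable \<kappa> U (state_at m (z \<tau>)) (state_at m z0)"
    using reachable_constant_control[OF mn(1) U(1), of \<tau> \<kappa> "z \<tau>"] \<tau> by simp
  moreover have "state_at m (z 0) = Some (of_real n)"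
    using state_at_change[OF mn(2), of m "z 0"] D0 N0 by (simp add: N_def D_def state_at_0)
  ultimately show ?thesis
    using reachable_trans[OF to_curve] by (simp add: z_def)
qed

text \<open>
  The coordinate of \<open>n\<^sup>2\<close> covers all states but \<open>- n\<close>. That one is not an equilibrium for
  \<open>m\<^sup>2\<close>: in the coordinate of \<open>m\<^sup>2\<close> it is neither \<open>0\<close> nor \<open>\<infinity>\<close>, so its modulus there strictly decreases
  and any positive time, such as \<open>1\<close>, leads away from it.
\<close>

lemma reachable_equilibrium:
  assumes \<kappa>: "Re \<kappa> > 0" "Im \<kappa> < 0" and mn: "m > 0" "n > 0" "m \<noteq> n"
    and U: "m\<^sup>2 \<in> U" "n\<^sup>2 \<in> U"
  shows "reachable \<kappa> U \<xi> (Some (of_real n))"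
proof -
  have off_repeller: "reachable \<kappa> U \<zeta> (Some (of_real n))"
    if \<zeta>: "\<zeta> \<noteq> Some (- of_real n)" for \<zeta>
  proof -
    obtain y where y: "\<zeta> = state_at n y"
      using state_at_exists[OF mn(2) \<zeta>] .
    show ?thesis
    proof (cases "y = 0")
      case True
      then show ?thesis
        using reachable_constant_control[OF mn(2) U(2) order_refl, of \<kappa> 0] y
        by (simp add: state_at_0)
    next
      case False
      then show ?thesis
        using reachable_equilibrium_from_basin[OF assms] y by blast
    qed
  qed
  show ?thesis
  proof (cases "\<xi> = Some (- of_real n)")
    case False
    then show ?thesis by (rule off_repeller)
  next
    case True
    define y :: complex where "y = of_real ((n + m) / (n - m))"
    have nz: "complex_of_real m + complex_of_real n \<noteq> 0"
      using mn by (simp flip: of_real_add)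
    have y: "y \<noteq> 0" "\<xi> = state_at m y"
      using mn nz True by (auto simp: y_def state_at_def projective_ratio_def field_simps)
    define Y where "Y = y * exp (- (2 * \<i> * \<kappa> * of_real m * of_real 1))"
    have "norm (exp (- (2 * \<i> * \<kappa> * of_real m * of_real 1))) < 1"
      using \<kappa> mn by (simp add: mult_neg_pos)
    then have "exp (- (2 * \<i> * \<kappa> * of_real m * of_real 1)) \<noteq> 1"
      by (metis norm_one less_irrefl)
    then have "Y \<noteq> y"
      using y(1) unfolding Y_def by simp
    have "state_at m Y \<noteq> Some (- of_real n)"
    proof
      assume "state_at m Y = Some (- of_real n)"
      then have "1 - Y \<noteq> 0" "of_real m * (1 + Y) / (1 - Y) = - of_real n"
        by (auto simp: state_at_def projective_ratio_def split: if_splits)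
      then have "of_real m * (1 + Y) = - of_real n * (1 - Y)"
        by (simp add: field_simps)
      then have "(of_real n - of_real m) * Y = of_real n + of_real m"
        by (simp add: algebra_simps)
      then have "Y = y"
        using mn by (simp add: y_def field_simps)
      with \<open>Y \<noteq> y\<close> show False ..
    qed
    then have "reachable \<kappa> U (state_at m Y) (Some (of_real n))"
      by (rule off_repeller)
    moreover have "reachable \<kappa> U \<xi> (state_at m Y)"
      using reachable_constant_control[OF mn(1) U(1), of 1 \<kappa> y] y(2) by (simp add: Y_def)
    ultimately show ?thesis
      by (metis reachable_trans)
  qed
qed

theorem theorem4p3:
  fixes n\<^sub>1 n\<^sub>2 s_minus \<eta>_plus :: real and \<kappa> :: complex
  assumes "0 < n\<^sub>1" and "n\<^sub>1 < n\<^sub>2"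
    and "Re \<kappa> > 0" and "Im \<kappa> < 0"
    and "\<eta>_plus \<in> {n\<^sub>1..n\<^sub>2}"
  shows "globally_controllable_to n\<^sub>1 n\<^sub>2 s_minus \<kappa> (Some (complex_of_real \<eta>_plus))"
proof -
  obtain m where m: "m \<in> {n\<^sub>1, n\<^sub>2}" "m \<noteq> \<eta>_plus"
    using assms(2) by (metis insertCI order_less_irrefl)
  have "\<eta>_plus > 0" "m > 0" "m\<^sup>2 \<in> {n\<^sub>1\<^sup>2..n\<^sub>2\<^sup>2}" "\<eta>_plus\<^sup>2 \<in> {n\<^sub>1\<^sup>2..n\<^sub>2\<^sup>2}"
    using assms m by (auto intro!: power_mono)
  then have "reachable \<kappa> {n\<^sub>1\<^sup>2..n\<^sub>2\<^sup>2} \<xi> (Some (of_real \<eta>_plus))" for \<xi>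
    using assms m by (intro reachable_equilibrium[of \<kappa> m]) auto
  then show ?thesis
    unfolding globally_controllable_to_def by (metis reachable_imp_steers)
qed

end
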